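(* Let $G$ be a directed acyclic graph with positive edge costs, start node $s$ and goal node $t\neq s$, let $r$ be the reward at $t$, and consider an agent with present-bias parameter $\beta\in[0,1]$. If $G^*$ is a minimal motivating subgraph of $G$ (from $s$ to $t$), then $G^*$ contains an $s$-$t$ path $P^*$ with the properties that (i) every edge of $G^*$ is either part of $P^*$ or lies on a $P^*$-bypass in $G^*$; and (ii) every node of $G^*$ has at most one outgoing edge that does not lie on $P^*$ (in other words, $G^*-E(P^* )$ has maximum out-degree at most $1$).
   Context: Reward model: in a directed acyclic graph $G'$ with edge costs $c(\cdot)$ and a reward $r$ at $t$, the agent starts at $s$. When standing at a node $v\neq t$, it evaluates each $v$-$t$ path $P$ in $G'$, with edges $e_1(P),e_2(P),\dots$, as $c(e_1(P))+\beta\sum_{i>1}c(e_i(P))$. If there is no $v$-$t$ path in $G'$, or if every $v$-$t$ path has evaluation strictly greater than $\beta r$, the agent quits. Otherwise it traverses the first edge $(v,w)$ of a $v$-$t$ path of minimum evaluation, and repeats the computation from $w$. If several out-neighbors of $v$ are tied as next node, ties are broken consistently: the agent goes to the tied out-neighbor that is earliest in a fixed linear ordering of the nodes of $G$ (for instance a fixed topological ordering), the same for all subgraphs of $G$. A subgraph $G'$ of $G$ (containing $s$ and $t$, obtained by deleting nodes and/or edges, with the inherited costs) is motivating if in $G'$ with reward $r$ the agent reaches $t$. A subgraph $G^*$ is a minimal motivating subgraph if $G^*$ is motivating and no proper subgraph of $G^*$ is motivating. Given a path $P$ in a directed acyclic graph, a path $Q$ (with at least one edge) is a $P$-bypass if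 the first and last nodes of $Q$ lie on $P$ and no other nodes of $Q$ do, i.e. $P\cap Q$ (as node sets) equals the two ends of $Q$. $E(P^* )$ is the edge set of $P^*$. *)

theory Defs
  imports "Graph_Theory.Graph_Theory"
begin

definition perceived_cost :: "('b \<Rightarrow> real) \<Rightarrow> real \<Rightarrow> 'b list \<Rightarrow> real" where
  "perceived_cost c \<beta> P = (case P of [] \<Rightarrow> 0 | e # es \<Rightarrow> c e + \<beta> * sum_list (map c es))"

definition continues :: "('a, 'b) pre_digraph \<Rightarrow> ('b \<Rightarrow> real) \<Rightarrow> real \<Rightarrow> real \<Rightarrow> 'a \<Rightarrow> 'a \<Rightarrow> bool" where
  "continues G c \<beta> r t v \<longleftrightarrow> (\<exists>P. pre_digraph.apath G v P t \<and> perceived_cost c \<beta> P \<le> \<beta> * r)"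

definition min_eval_path :: "('a, 'b) pre_digraph \<Rightarrow> ('b \<Rightarrow> real) \<Rightarrow> real \<Rightarrow> 'a \<Rightarrow> 'a \<Rightarrow> 'b list \<Rightarrow> bool" where
  "min_eval_path G c \<beta> t v P \<longleftrightarrow> pre_digraph.apath G v P t \<and>
     (\<forall>Q. pre_digraph.apath G v Q t \<longrightarrow> perceived_cost c \<beta> P \<le> perceived_cost c \<beta> Q)"

definition tied_next :: "('a, 'b) pre_digraph \<Rightarrow> ('b \<Rightarrow> real) \<Rightarrow> real \<Rightarrow> 'a \<Rightarrow> 'a \<Rightarrow> 'a set" where
  "tied_next G c \<beta> t v = {head G e | e es. min_eval_path G c \<beta> t v (e # es)}"

text \<open>\<open>ord\<close> is the tie-breaking order; \<open>(w, w') \<in> ord\<close> means that \<open>w\<close> is equal to or earlier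
  than \<open>w'\<close>.\<close>

definition agent_step ::
  "('a, 'b) pre_digraph \<Rightarrow> ('b \<Rightarrow> real) \<Rightarrow> real \<Rightarrow> real \<Rightarrow> 'a rel \<Rightarrow> 'a \<Rightarrow> 'a \<Rightarrow> 'a \<Rightarrow> bool" where
  "agent_step G c \<beta> r ord t v w \<longleftrightarrow> v \<noteq> t \<and> continues G c \<beta> r t v \<and>
     w \<in> tied_next G c \<beta> t v \<and> (\<forall>w' \<in> tied_next G c \<beta> t v. (w, w') \<in> ord)"

definition motivating_subgraph ::
  "('a, 'b) pre_digraph \<Rightarrow> ('b \<Rightarrow> real) \<Rightarrow> real \<Rightarrow> real \<Rightarrow> 'a rel \<Rightarrow> 'a \<Rightarrow> 'a \<Rightarrow> ('a, 'b) pre_digraph \<Rightarrow> bool" where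
  "motivating_subgraph G c \<beta> r ord s t H \<longleftrightarrow> subgraph H G \<and> s \<in> verts H \<and> t \<in> verts H \<and>
     (agent_step H c \<beta> r ord t)\<^sup>*\<^sup>* s t"

definition minimal_motivating_subgraph ::
  "('a, 'b) pre_digraph \<Rightarrow> ('b \<Rightarrow> real) \<Rightarrow> real \<Rightarrow> real \<Rightarrow> 'a rel \<Rightarrow> 'a \<Rightarrow> 'a \<Rightarrow> ('a, 'b) pre_digraph \<Rightarrow> bool" where
  "minimal_motivating_subgraph G c \<beta> r ord s t H \<longleftrightarrow> motivating_subgraph G c \<beta> r ord s t H \<and>
     (\<forall>H'. subgraph H' H \<and> H' \<noteq> H \<longrightarrow> \<not> motivating_subgraph G c \<beta> r ord s t H')"

text \<open>Paths are arc lists, so a path \<open>P\<close> is given together with its first node \<open>u\<close>, from which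
  its node set is computed. As bypasses contain an edge and paths have distinct nodes, the two ends
  \<open>x\<close> and \<open>y\<close> of \<open>Q\<close> are different.\<close>

definition is_bypass :: "('a, 'b) pre_digraph \<Rightarrow> 'a \<Rightarrow> 'b list \<Rightarrow> 'b list \<Rightarrow> bool" where
  "is_bypass G u P Q \<longleftrightarrow> Q \<noteq> [] \<and>
     (\<exists>x y. pre_digraph.apath G x Q y \<and>
        set (pre_digraph.awalk_verts G u P) \<inter> set (pre_digraph.awalk_verts G x Q) = {x, y})"

end

theory Submission
  imports Defs
begin

text \<open>
  Let \<open>P\<close> be the path that the agent follows in \<open>Gs\<close>. Choose one shortest path to \<open>t\<close> from every
  node so that together they use at most one arc out of each node. Keep only the arcs of \<open>P\<close> and
  those of the chosen paths that start on \<open>P\<close>. In the remaining graph the agent still sees, at each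
  node of \<open>P\<close>, an optimal plan with the same first arc, and it sees no new plans; so it still
  follows \<open>P\<close>. By minimality no arc was removed, which gives (ii). Every chosen path starts and ends
  on \<open>P\<close>, so cutting it at the nodes of \<open>P\<close> gives (i).
\<close>

section \<open>Walks in acyclic digraphs\<close>

context wf_digraph begin

text \<open>\<open>forest\<close> forbids only directed cycles, so it expresses acyclicity and not a
  tree shape. A nonempty closed walk would yield a cycle.\<close>

lemma forest_awalk_closed:
  assumes "forest G" "awalk u p u"
  shows "p = []"
  using assms closed_w_imp_cycle[of p] by (auto simp: forest_def closed_w_def)

lemma forest_awalk_imp_apath:
  assumes "forest G" "awalk u p v"
  shows "apath u p v"
proof (rule ccontr)
  assume "\<not> apath u p v"
  with assms(2) have "\<not> distinct (awalk_verts u p)" by (auto simp: apath_def)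
  from awalk_not_distinct_decomp[OF assms(2) this] obtain r w
    where "0 < length r" "awalk w r w" by blast
  with forest_awalk_closed[OF assms(1)] show False by blast
qed

lemma awalk_subgraph:
  assumes "subgraph H G" "awalk u p v" "set p \<subseteq> arcs H" "u \<in> verts H"
  shows "pre_digraph.awalk H u p v"
proof -
  have "compatible G H" using assms(1) by auto
  from compatible_cas[OF this] assms show ?thesis by (simp add: pre_digraph.awalk_def)
qed

lemma last_in_awalk_verts:
  assumes "awalk u p v"
  shows "v \<in> set (awalk_verts u p)"
proof -
  have "awlast u p = v" using assms by auto
  then show ?thesis by (metis awalk_verts_non_Nil last_in_set)
qed

text \<open>Used to cut a walk into bypasses. If the walk meets \<open>S\<close> at a node other
  than its ends, split it there and continue with the half that contains \<open>e\<close>; both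
  halves are shorter and again have their ends in \<open>S\<close>.\<close>

lemma awalk_segment_between:
  assumes "awalk x q y" "x \<in> S" "y \<in> S" "e \<in> set q"
  shows "\<exists>x' q' y'. awalk x' q' y' \<and> set (awalk_verts x' q') \<inter> S = {x', y'} \<and> e \<in> set q'"
  using assms
proof (induction "length q" arbitrary: x q y rule: less_induct)
  case less
  show ?case
  proof (cases "set (awalk_verts x q) \<inter> S = {x, y}")
    case True
    with less.prems show ?thesis by blast
  next
    case False
    with hd_in_awalk_verts(1)[OF less.prems(1)] last_in_awalk_verts[OF less.prems(1)]
    obtain z where z: "z \<in> set (awalk_verts x q)" "z \<in> S" "z \<noteq> x" "z \<noteq> y"
      using less.prems(2,3) by auto
    from awalk_decomp[OF less.prems(1) z(1)] obtain a b
      where ab: "q = a @ b" "awalk x a z" "awalk z b y" by blast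
    with z have "a \<noteq> []" "b \<noteq> []" by (auto simp: awalk_Nil_iff)
    then have "length a < length q" "length b < length q" using ab(1) by auto
    then show ?thesis
      using less.hyps[of a x z] less.hyps[of b z y] ab less.prems z(2) by auto
  qed
qed

end

section \<open>A consistent choice of shortest paths\<close>

text \<open>A tail of a cheapest walk is cheapest, so always following the first arc
  \<open>f v\<close> of a preferred cheapest walk gives a cheapest walk to \<open>t\<close>. One
  function \<open>f\<close> serves all start nodes, so these walks together use at most one arc out
  of each node.\<close>

lemma (in fin_digraph) shortest_awalks_choice:
  fixes c :: "'b \<Rightarrow> real"
  assumes "forest G"
  shows "\<exists>f. \<forall>v p. awalk v p t \<longrightarrow> (\<exists>q. awalk v q t \<and>
    (\<forall>q'. awalk v q' t \<longrightarrow> sum_list (map c q) \<le> sum_list (map c q')) \<and>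
    (\<forall>e \<in> set q. f (tail G e) = e))"
proof -
  define sp where "sp v p \<longleftrightarrow> awalk v p t \<and>
    (\<forall>q. awalk v q t \<longrightarrow> sum_list (map c p) \<le> sum_list (map c q))" for v p
  \<comment> \<open>Among the cheapest walks, one with fewest arcs is taken: its tail is then
    shorter than every cheapest walk from \<open>v\<close>, which drives the induction in
    \<open>tree\<close>.\<close>
  define g where "g v = arg_min length (sp v)" for v
  define f where "f v = hd (g v)" for v
  have ex: "\<exists>p. sp v p" if "awalk v q t" for v q
  proof -
    \<comment> \<open>By acyclicity all walks are paths, so there are finitely many and a cheapest
      one exists, whatever the signs of the costs.\<close>
    have "finite {p. awalk v p t}"
      using forest_awalk_imp_apath[OF assms] apaths_finite[of v t]
      by (auto elim!: rev_finite_subset)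
    then have "\<exists>p. is_arg_min (\<lambda>p. sum_list (map c p)) (\<lambda>p. p \<in> {p. awalk v p t}) p"
      using that by (intro ex_is_arg_min_if_finite) auto
    then show ?thesis by (auto simp: sp_def is_arg_min_linorder)
  qed
  have g: "sp v (g v)" "length (g v) \<le> length p" if "sp v p" for v p
    using arg_min_natI[of "sp v" p length] arg_min_nat_le[of "sp v" p length] that
    by (auto simp: g_def)
  have tree: "\<exists>q. sp v q \<and> (\<forall>e \<in> set q. f (tail G e) = e)" if "sp v p" for v p
    using that
  proof (induction "length p" arbitrary: v p rule: less_induct)
    case less
    show ?case
    proof (cases "g v")
      case Nil
      with g(1)[OF less.prems] show ?thesis by (intro exI[of _ "[]"]) simp
    next
      case (Cons e es)
      with g(1)[OF less.prems] have e: "sp v (e # es)" by simp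
      then have v: "e \<in> arcs G" "v = tail G e" "awalk (head G e) es t"
        by (auto simp: sp_def awalk_Cons_iff)
      have "sum_list (map c es) \<le> sum_list (map c q)" if "awalk (head G e) q t" for q
      proof -
        have "awalk v (e # q) t" using v that by (simp add: awalk_Cons_iff)
        with e show ?thesis unfolding sp_def by force
      qed
      with v have "sp (head G e) es" by (simp add: sp_def)
      moreover have "length es < length p" using g(2)[OF less.prems] Cons by simp
      ultimately obtain q where q: "sp (head G e) q" "\<forall>e \<in> set q. f (tail G e) = e"
        using less.hyps by blast
      have "sum_list (map c q) \<le> sum_list (map c es)"
        using q v by (auto simp: sp_def)
      then have "sum_list (map c (e # q)) \<le> sum_list (map c (e # es))" by simp
      moreover have "awalk v (e # q) t" using q(1) v by (simp add: sp_def awalk_Cons_iff)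
      ultimately have "sp v (e # q)" using e unfolding sp_def by (meson order_trans)
      moreover have "f v = e" using Cons by (simp add: f_def)
      ultimately show ?thesis using q(2) v(2) by (intro exI[of _ "e # q"]) simp
    qed
  qed
  show ?thesis
  proof (intro exI[of _ f] allI impI)
    fix v p assume "awalk v p t"
    then obtain p' where "sp v p'" using ex by blast
    from tree[OF this] show "\<exists>q. awalk v q t \<and>
      (\<forall>q'. awalk v q' t \<longrightarrow> sum_list (map c q) \<le> sum_list (map c q')) \<and>
      (\<forall>e \<in> set q. f (tail G e) = e)"
      by (simp add: sp_def conj_assoc)
  qed
qed

section \<open>Steps of the agent and their survival in subgraphs\<close>

lemma agent_step_arc:
  assumes "agent_step H c \<beta> r ord t v w" "wf_digraph H"
  obtains e es where "min_eval_path H c \<beta> t v (e # es)" "head H e = w" "tail H e = v" "e \<in> arcs H"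
proof -
  interpret wf_digraph H by fact
  from assms(1) obtain e es where e: "min_eval_path H c \<beta> t v (e # es)" "head H e = w"
    by (auto simp: agent_step_def tied_next_def)
  then have "e \<in> arcs H" "tail H e = v" by (auto simp: min_eval_path_def apath_Cons_iff)
  with e that show thesis by blast
qed

text \<open>The step relation records nodes only. For each step an arc that begins an optimal plan
  is selected, which makes the route an arc list.\<close>

lemma agent_walk:
  assumes "(agent_step H c \<beta> r ord t)\<^sup>*\<^sup>* s t" "wf_digraph H" "t \<in> verts H"
  shows "\<exists>P. pre_digraph.awalk H s P t \<and>
    (\<forall>e \<in> set P. agent_step H c \<beta> r ord t (tail H e) (head H e) \<and>
      (\<exists>es. min_eval_path H c \<beta> t (tail H e) (e # es)))"
proof -
  interpret wf_digraph H by fact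
  from assms(1) show ?thesis
  proof (induction rule: converse_rtranclp_induct)
    case base
    with assms(3) show ?case by (intro exI[of _ "[]"]) (simp add: awalk_Nil_iff)
  next
    case (step v w)
    then obtain P where P: "awalk w P t"
      "\<forall>e \<in> set P. agent_step H c \<beta> r ord t (tail H e) (head H e) \<and>
        (\<exists>es. min_eval_path H c \<beta> t (tail H e) (e # es))" by blast
    obtain e es where e: "min_eval_path H c \<beta> t v (e # es)" "head H e = w" "tail H e = v" "e \<in> arcs H"
      using agent_step_arc[OF step.hyps(1) assms(2)] .
    with P step.hyps(1) show ?case by (intro exI[of _ "e # P"]) (auto simp: awalk_Cons_iff)
  qed
qed

text \<open>Since an optimal plan survives in \<open>H\<close>, the minimum evaluation is unchanged
  and every optimal plan of \<open>H\<close> is optimal in \<open>G\<close>. The set of tied nodes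
  can only shrink and keeps \<open>head G e\<close>, which therefore stays the earliest.\<close>

lemma agent_step_subgraph:
  assumes "subgraph H G" "agent_step G c \<beta> r ord t v (head G e)"
    and "min_eval_path G c \<beta> t v (e # es)" "pre_digraph.apath H v (e # es) t"
  shows "agent_step H c \<beta> r ord t v (head G e)"
proof -
  interpret wf_digraph G using assms(1) by auto
  have hd: "head H = head G" using assms(1) by (auto simp: subgraph_def compatible_def)
  have sub: "apath u p w" if "pre_digraph.apath H u p w" for u p w
    using that assms(1) by (rule subgraph_apath_imp_apath)
  have "min_eval_path H c \<beta> t v (e # es)"
    using assms(3,4) sub by (auto simp: min_eval_path_def)
  then have in_H: "head G e \<in> tied_next H c \<beta> t v" by (auto simp: tied_next_def hd)
  have "min_eval_path G c \<beta> t v p" if "min_eval_path H c \<beta> t v p" for p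
    using that assms(3,4) sub unfolding min_eval_path_def by (meson order_trans)
  then have "tied_next H c \<beta> t v \<subseteq> tied_next G c \<beta> t v" by (fastforce simp: tied_next_def hd)
  moreover have "continues H c \<beta> r t v"
    using assms(2-4) unfolding agent_step_def continues_def min_eval_path_def
    by (meson order_trans)
  ultimately show ?thesis using assms(2) in_H by (auto simp: agent_step_def)
qed

lemma agent_follows_awalk:
  assumes "wf_digraph G" "pre_digraph.awalk G s P t"
    and "\<forall>e \<in> set P. agent_step H c \<beta> r ord t (tail G e) (head G e)"
  shows "(agent_step H c \<beta> r ord t)\<^sup>*\<^sup>* s t"
proof -
  interpret wf_digraph G by fact
  from assms(2,3) show ?thesis
  proof (induction P arbitrary: s)
    case Nil
    then show ?case by (simp add: awalk_Nil_iff)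
  next
    case (Cons e P)
    then show ?case by (auto simp: awalk_Cons_iff intro: converse_rtranclp_into_rtranclp)
  qed
qed

section \<open>Pruning a minimal motivating subgraph\<close>

theorem theorem5p1:
  fixes G Gs :: "('a, 'b) pre_digraph"
    and c :: "'b \<Rightarrow> real" and \<beta> r :: real and ord :: "'a rel" and s t :: 'a
  assumes "digraph G"
    and acyclic: "\<nexists>p. pre_digraph.cycle G p"
    and cost_pos: "\<And>e. e \<in> arcs G \<Longrightarrow> c e > 0"
    and "s \<in> verts G" and "t \<in> verts G" and "t \<noteq> s"
    and "0 \<le> \<beta>" and "\<beta> \<le> 1"
    and "linear_order_on (verts G) ord"
    and "minimal_motivating_subgraph G c \<beta> r ord s t Gs"
  shows "\<exists>P. pre_digraph.apath Gs s P t \<and>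
    (\<forall>e \<in> arcs Gs. e \<in> set P \<or> (\<exists>Q. is_bypass Gs s P Q \<and> e \<in> set Q)) \<and>
    (\<forall>v \<in> verts Gs. card (out_arcs Gs v - set P) \<le> 1)"
proof -
  interpret G: digraph G by fact
  have sub: "subgraph Gs G" and t: "t \<in> verts Gs" and s: "s \<in> verts Gs"
    and reach: "(agent_step Gs c \<beta> r ord t)\<^sup>*\<^sup>* s t"
    and min: "\<And>H. subgraph H Gs \<Longrightarrow> motivating_subgraph G c \<beta> r ord s t H \<Longrightarrow> H = Gs"
    using assms(10) by (auto simp: minimal_motivating_subgraph_def motivating_subgraph_def)
  interpret fin_digraph Gs
    using sub G.fin_digraph_axioms
    by (auto simp: fin_digraph_def fin_digraph_axioms_def subgraph_def elim: finite_subset)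
  have forest: "forest Gs"
    using acyclic G.subgraph_cycle[OF sub] by (auto simp: forest_def)
  from agent_walk[OF reach wf_digraph_axioms t] obtain P where P: "awalk s P t"
    and stepP: "\<And>e. e \<in> set P \<Longrightarrow> agent_step Gs c \<beta> r ord t (tail Gs e) (head Gs e)"
    and planP: "\<And>e. e \<in> set P \<Longrightarrow> \<exists>es. min_eval_path Gs c \<beta> t (tail Gs e) (e # es)" by blast
  obtain f where f: "\<And>v p. awalk v p t \<Longrightarrow> \<exists>q. awalk v q t \<and>
    (\<forall>q'. awalk v q' t \<longrightarrow> sum_list (map c q) \<le> sum_list (map c q')) \<and>
    (\<forall>e \<in> set q. f (tail Gs e) = e)"
    using shortest_awalks_choice[OF forest] by blast
  have "\<exists>q. awalk (head Gs e) q t \<and>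
    (\<forall>q'. awalk (head Gs e) q' t \<longrightarrow> sum_list (map c q) \<le> sum_list (map c q')) \<and>
    (\<forall>e' \<in> set q. f (tail Gs e') = e')" if e: "e \<in> set P" for e
  proof -
    obtain es where "min_eval_path Gs c \<beta> t (tail Gs e) (e # es)" using planP[OF e] ..
    then have "awalk (head Gs e) es t"
      by (auto simp: min_eval_path_def apath_def awalk_Cons_iff)
    then show ?thesis by (rule f)
  qed
  then obtain T where T: "\<And>e. e \<in> set P \<Longrightarrow> awalk (head Gs e) (T e) t"
    and T_le: "\<And>e q. e \<in> set P \<Longrightarrow> awalk (head Gs e) q t \<Longrightarrow>
      sum_list (map c (T e)) \<le> sum_list (map c q)"
    and T_f: "\<And>e e'. e \<in> set P \<Longrightarrow> e' \<in> set (T e) \<Longrightarrow> f (tail Gs e') = e'"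
    by metis
  \<comment> \<open>All nodes are kept, so \<open>H = Gs\<close> will be a statement about arcs
    alone.\<close>
  define H where "H = Gs\<lparr>arcs := set P \<union> (\<Union>e \<in> set P. set (T e))\<rparr>"
  have "arcs H \<subseteq> arcs Gs" using P T by (fastforce simp: H_def awalk_def)
  then have HGs: "subgraph H Gs"
    by (auto simp: subgraph_def compatible_def H_def wf_digraph_def)
  have stepH: "agent_step H c \<beta> r ord t (tail Gs e) (head Gs e)" if e: "e \<in> set P" for e
  proof -
    obtain es where es: "min_eval_path Gs c \<beta> t (tail Gs e) (e # es)" using planP[OF e] ..
    then have e_es: "e \<in> arcs Gs" "awalk (head Gs e) es t"
      by (auto simp: min_eval_path_def apath_def awalk_Cons_iff)
    have walk: "awalk (tail Gs e) (e # T e) t" using e_es T[OF e] by (simp add: awalk_Cons_iff)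
    \<comment> \<open>The evaluation charges the first arc fully and the rest with the factor
      \<beta> \<ge> 0, so a cheapest continuation after \<open>e\<close> preserves
      optimality.\<close>
    have "perceived_cost c \<beta> (e # T e) \<le> perceived_cost c \<beta> (e # es)"
      using T_le[OF e e_es(2)] \<open>0 \<le> \<beta>\<close> by (simp add: perceived_cost_def mult_left_mono)
    then have plan: "min_eval_path Gs c \<beta> t (tail Gs e) (e # T e)"
      using es forest_awalk_imp_apath[OF forest walk] unfolding min_eval_path_def
      by (meson order_trans)
    interpret H: wf_digraph H using HGs by auto
    have "H.awalk (tail Gs e) (e # T e) t"
      using awalk_subgraph[OF HGs walk] e e_es(1) by (auto simp: H_def)
    moreover have "forest H" using forest subgraph_cycle[OF HGs] by (auto simp: forest_def)
    ultimately have "H.apath (tail Gs e) (e # T e) t" by (intro H.forest_awalk_imp_apath)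
    with agent_step_subgraph[OF HGs stepP[OF e] plan] show ?thesis by blast
  qed
  have "(agent_step H c \<beta> r ord t)\<^sup>*\<^sup>* s t"
    using agent_follows_awalk[OF wf_digraph_axioms P] stepH by blast
  moreover have "subgraph H G" using subgraph_trans[OF HGs sub] .
  ultimately have "motivating_subgraph G c \<beta> r ord s t H"
    using s t by (simp add: motivating_subgraph_def H_def)
  then have "H = Gs" using min[OF HGs] by blast
  then have arcs: "arcs Gs = set P \<union> (\<Union>e \<in> set P. set (T e))"
    by (metis H_def pre_digraph.select_convs(2) pre_digraph.surjective pre_digraph.update_convs(2))
  show ?thesis
  proof (intro exI[of _ P] conjI ballI)
    show "apath s P t" using forest_awalk_imp_apath[OF forest P] .
  next
    fix e assume "e \<in> arcs Gs"
    then consider "e \<in> set P" | e' where "e' \<in> set P" "e \<in> set (T e')"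
      unfolding arcs by blast
    then show "e \<in> set P \<or> (\<exists>Q. is_bypass Gs s P Q \<and> e \<in> set Q)"
    proof cases
      case 2
      let ?S = "set (awalk_verts s P)"
      \<comment> \<open>Both ends of \<open>T e'\<close> lie on \<open>P\<close>, so the segment of
        it around \<open>e\<close> that meets \<open>P\<close> only in its ends is a bypass.\<close>
      have "head Gs e' \<in> ?S" using awalk_verts_arc2[OF P 2(1)] .
      moreover have "t \<in> ?S" using last_in_awalk_verts[OF P] .
      ultimately obtain x Q y where Q: "awalk x Q y" "set (awalk_verts x Q) \<inter> ?S = {x, y}" "e \<in> set Q"
        using awalk_segment_between[OF T[OF 2(1)] _ _ 2(2)] by blast
      then have "is_bypass Gs s P Q"
        using forest_awalk_imp_apath[OF forest Q(1)] unfolding is_bypass_def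
        by (auto simp: Int_commute)
      with Q(3) show ?thesis by blast
    qed simp
  next
    fix v
    \<comment> \<open>An arc outside \<open>P\<close> lies on some \<open>T e\<close>, hence is the
      arc that \<open>f\<close> assigns to its tail.\<close>
    have "out_arcs Gs v - set P \<subseteq> {f v}"
      using T_f arcs by auto
    then show "card (out_arcs Gs v - set P) \<le> 1"
      using card_mono[of "{f v}"] by simp
  qed
qed

end
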